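(* Let $a\in(0,1)$, $c\in(0,a)$, and let $P(z) = (z-a)\prod_{j=1}^{n-1}(z-z_j)$ be a polynomial of degree $n$ that contradicts Sendov's conjecture at $a$. Define $\mathcal{N}_0(a) = \frac{32 \log ( 40/a^2 )}{a^2}$, $$\mathcal{N}_1(a) = \max \left \{ 9 \left( \frac{4+2a}{a} \right)^2 , \mathcal{N}_0(a) \right \},\qquad \mathcal{N}_2(a,c) = \max \left \{ 9 \left( \frac{\log ( a/16 )}{\log \left( \frac{c}{1+a} \right) } \right)^2 , \mathcal{N}_0(a) \right \}.$$ If $n \geq \max \{\mathcal{N}_1(a), \mathcal{N}_2(a,c)\}$, then $|P(c)| \leq 1 + a$.
   Context: A polynomial $P(z) = (z-a)\prod_{j=1}^{n-1}(z-z_j)$ with $a\in(0,1)$ and $|z_j|\le 1$ for all $j$ is said to contradict Sendov's conjecture at $a$ if every zero $w$ of $P'$ satisfies $|w-a|>1$. *)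

theory Defs
  imports "HOL-Analysis.Analysis" "HOL-Computational_Algebra.Polynomial"
begin

definition sendov_poly :: "real \<Rightarrow> (nat \<Rightarrow> complex) \<Rightarrow> nat \<Rightarrow> complex poly" where
  "sendov_poly a zs n = [:- complex_of_real a, 1:] * (\<Prod>j=1..n-1. [:- zs j, 1:])"

definition contradicts_sendov :: "real \<Rightarrow> (nat \<Rightarrow> complex) \<Rightarrow> nat \<Rightarrow> bool" where
  "contradicts_sendov a zs n \<longleftrightarrow>
     0 < a \<and> a < 1 \<and> (\<forall>j\<in>{1..n-1}. cmod (zs j) \<le> 1) \<and>
     (\<forall>w. poly (pderiv (sendov_poly a zs n)) w = 0 \<longrightarrow> cmod (w - complex_of_real a) > 1)"

definition N0 :: "real \<Rightarrow> real" where
  "N0 a = 32 * ln (40 / a^2) / a^2"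

definition N1 :: "real \<Rightarrow> real" where
  "N1 a = max (9 * ((4 + 2*a) / a)^2) (N0 a)"

definition N2 :: "real \<Rightarrow> real \<Rightarrow> real" where
  "N2 a c = max (9 * (ln (a/16) / ln (c / (1 + a)))^2) (N0 a)"

end

theory Submission
  imports Defs "HOL-Computational_Algebra.Fundamental_Theorem_Algebra"
begin

text \<open>
  Let \<open>w\<^sub>j\<close> be the \<open>N = n - 1\<close> critical points of \<open>P\<close>. By Gauss--Lucas and the hypothesis they lie in the
  lune \<open>\<bar>w\<bar> \<le> 1 < \<bar>w - a\<bar>\<close>, so \<open>\<bar>P'\<bar>\<close> is exponentially smaller in the middle of \<open>[0, a]\<close> than at \<open>a\<close>,
  while \<open>\<bar>P'(a)\<bar> \<ge> n\<close>. Integrating \<open>P'\<close> by parts against \<open>R = P''/P'\<close> near \<open>a\<close>, where \<open>Re R \<ge> N a / 4\<close>,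
  gives \<open>P(t) \<approx> P(3a/4) + P'(t)/R(t)\<close>; at \<open>t = a\<close> this shows that the plateau value \<open>P(3a/4)\<close> has
  modulus about \<open>\<bar>P'(a)/R(a)\<bar>\<close>, hence is not much smaller than \<open>1\<close>.

  Zeros and critical points share their centroid, whose real part we call \<open>\<mu>\<close>. If \<open>\<mu> \<ge> a/4\<close>, then
  \<open>\<bar>P(\<mu>)\<bar> \<le> exp (- n \<mu>\<^sup>2 / 2)\<close> by the inequality of the means, contradicting the plateau. If
  \<open>\<mu> < a/4\<close>, then \<open>P'\<close> is negligible on all of \<open>[0, 3a/4]\<close>, so the plateau value is about \<open>P(0)\<close>, of
  modulus at most \<open>a\<close>. This forces \<open>a \<ge> 17/20\<close>, and the approximation of \<open>P\<close> on \<open>[3a/4, a]\<close> then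
  gives the bound.
\<close>

section \<open>Points of the lune\<close>

text \<open>Such a point is nearer to 0 than to \<open>a\<close>, so it lies to the left of their
  perpendicular bisector.\<close>

lemma lune_Re_less:
  fixes a :: real and w :: complex
  assumes "0 < a" "cmod w \<le> 1" "1 < cmod (w - of_real a)"
  shows "Re w < a / 2"
proof -
  have "(cmod w)\<^sup>2 < (cmod (w - of_real a))\<^sup>2"
    by (rule power_strict_mono) (use assms in auto)
  hence "a * (2 * Re w) < a * a"
    unfolding cmod_power2 by (simp add: power2_eq_square algebra_simps)
  thus ?thesis
    using assms(1) by simp
qed

lemma cmod_of_real_diff_sq:
  "(cmod (of_real t - w))\<^sup>2 = t\<^sup>2 - 2 * t * Re w + (cmod w)\<^sup>2"
  unfolding cmod_power2 by (simp add: power2_eq_square algebra_simps)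

text \<open>Passing from \<open>a\<close> to \<open>t\<close> lowers the squared distance
  \<open>A\<close> by \<open>(a - t) * (a + t - 2 * Re w)\<close>. This is at least
  \<open>t * (a - t) * A\<close>, because |w| \<le> 1 gives
  \<open>A \<le> 1 + a * (a - 2 * Re w)\<close> and \<open>t * a \<le> 1\<close>. The multiplicative
  form allows a product over all critical points.\<close>

lemma lune_dist_sq_le_exp:
  fixes a t :: real and w :: complex
  assumes a: "0 < a" "a < 1" and w: "cmod w \<le> 1" "1 < cmod (w - of_real a)"
    and t: "0 \<le> t" "t \<le> a"
  shows "(cmod (of_real t - w))\<^sup>2 \<le> (cmod (of_real a - w))\<^sup>2 * exp (- (t * (a - t)))"
proof -
  define A where "A = (cmod (of_real a - w))\<^sup>2"
  have re: "Re w < a / 2"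
    using lune_Re_less a(1) w by blast
  have w1: "(cmod w)\<^sup>2 \<le> 1"
    using w(1) by (simp add: power_le_one)
  have A: "A = a\<^sup>2 - 2 * a * Re w + (cmod w)\<^sup>2"
    unfolding A_def by (rule cmod_of_real_diff_sq)
  have "t * A \<le> t * (1 + a * (a - 2 * Re w))"
    using t w1 by (intro mult_left_mono) (auto simp: A power2_eq_square algebra_simps)
  also have "\<dots> = t + (t * a) * (a - 2 * Re w)"
    by (simp add: algebra_simps)
  also have "\<dots> \<le> t + 1 * (a - 2 * Re w)"
    using re t a by (intro add_left_mono mult_right_mono mult_le_one) auto
  finally have "(a - t) * (t * A) \<le> (a - t) * (a + t - 2 * Re w)"
    using t by (intro mult_left_mono) auto
  moreover have "(cmod (of_real t - w))\<^sup>2 = A - (a - t) * (a + t - 2 * Re w)"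
    unfolding cmod_of_real_diff_sq A by (simp add: power2_eq_square algebra_simps)
  ultimately have "(cmod (of_real t - w))\<^sup>2 \<le> A * (1 + - (t * (a - t)))"
    by (simp add: algebra_simps)
  also have "\<dots> \<le> A * exp (- (t * (a - t)))"
    by (intro mult_left_mono exp_ge_add_one_self) (simp add: A_def)
  finally show ?thesis
    by (simp add: A_def)
qed

text \<open>The same decrease, now compared with the crude bound \<open>A \<le> 4\<close>. The
  exponent remains useful at \<open>t = 0\<close>, where \<open>t * (a - t)\<close> vanishes, and it
  is affine in \<open>Re w\<close>, so summing it brings in the centroid.\<close>

lemma lune_dist_sq_le_exp_Re:
  fixes a t :: real and w :: complex
  assumes a: "0 < a" "a < 1" and w: "cmod w \<le> 1" "1 < cmod (w - of_real a)"
    and t: "0 \<le> t" "t \<le> a"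
  shows "(cmod (of_real t - w))\<^sup>2
    \<le> (cmod (of_real a - w))\<^sup>2 * exp (- ((a - t) * (a + t - 2 * Re w) / 4))"
proof -
  define A where "A = (cmod (of_real a - w))\<^sup>2"
  define u where "u = (a - t) * (a + t - 2 * Re w)"
  have re: "Re w < a / 2"
    using lune_Re_less a(1) w by blast
  have u: "0 \<le> u"
    unfolding u_def using t re by (intro mult_nonneg_nonneg) auto
  have "cmod (of_real a - w) \<le> cmod (of_real a :: complex) + cmod w"
    by (rule norm_triangle_ineq4)
  also have "\<dots> \<le> 2"
    using a w by simp
  finally have "A \<le> 2\<^sup>2"
    unfolding A_def by (intro power_mono) auto
  hence "u * A \<le> u * 4"
    using u by (intro mult_left_mono) auto
  moreover have "(cmod (of_real t - w))\<^sup>2 = A - u"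
    unfolding u_def A_def cmod_of_real_diff_sq by (simp add: power2_eq_square algebra_simps)
  ultimately have "(cmod (of_real t - w))\<^sup>2 \<le> A * (1 + - (u / 4))"
    by (simp add: algebra_simps)
  also have "\<dots> \<le> A * exp (- (u / 4))"
    by (intro mult_left_mono exp_ge_add_one_self) (simp add: A_def)
  finally show ?thesis
    by (simp add: A_def u_def)
qed

text \<open>The real part equals \<open>(t - Re w) / B\<close>. In terms of \<open>s\<close> and
  \<open>u\<close> its numerator is \<open>u + s\<close>, while
  \<open>B \<le> 1 + 2 * t * s\<close>; so \<open>u * B \<le> u + s\<close> reduces to
  \<open>2 * u * t \<le> 1\<close>. The second bound follows from \<open>Re w < a / 2\<close>
  alone.\<close>

lemma
  fixes a t :: real and w :: complex
  assumes a: "0 < a" "a < 1" and w: "cmod w \<le> 1" "1 < cmod (w - of_real a)"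
    and t: "a / 2 \<le> t" "t \<le> a"
  shows lune_Re_inverse_ge: "t - a / 2 \<le> Re (1 / (of_real t - w))"
    and lune_Re_inverse_ge_norm: "(t - a / 2) * cmod (1 / (of_real t - w)\<^sup>2) \<le> Re (1 / (of_real t - w))"
proof -
  have re: "Re w < a / 2"
    using lune_Re_less a(1) w by blast
  define B where "B = (cmod (of_real t - w))\<^sup>2"
  have ne: "of_real t - w \<noteq> 0"
    using re t by (auto simp: complex_eq_iff)
  hence B0: "B > 0"
    by (simp add: B_def)
  have Re_eq: "Re (1 / (of_real t - w)) = (t - Re w) / B"
    unfolding B_def cmod_power2 by (simp add: Re_divide)
  have w1: "(cmod w)\<^sup>2 \<le> 1"
    using w(1) by (simp add: power_le_one)
  define s u where "s = a / 2 - Re w" and "u = t - a / 2"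
  have su: "s \<ge> 0" "u \<ge> 0" "u \<le> a / 2"
    using re t by (auto simp: s_def u_def)
  have "B \<le> t\<^sup>2 - 2 * t * Re w + 1"
    unfolding B_def cmod_of_real_diff_sq using w1 by simp
  also have "\<dots> = 1 - t * (a - t) + 2 * t * s"
    by (simp add: s_def power2_eq_square algebra_simps)
  also have "\<dots> \<le> 1 + 2 * t * s"
    using t a by simp
  finally have "u * B \<le> u * (1 + 2 * t * s)"
    using su by (intro mult_left_mono) auto
  also have "\<dots> = u + s * ((2 * u) * t)"
    by (simp add: algebra_simps)
  also have "\<dots> \<le> u + s * 1"
  proof -
    have "(2 * u) * t \<le> 1"
      by (rule mult_le_one) (use su t a in auto)
    thus ?thesis
      using su by (intro add_left_mono mult_left_mono) auto
  qed
  finally have "u * B \<le> t - Re w"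
    by (simp add: s_def u_def)
  thus "t - a / 2 \<le> Re (1 / (of_real t - w))"
    unfolding Re_eq u_def using B0 by (simp add: field_simps)
  have "(t - a / 2) / B \<le> (t - Re w) / B"
    using re B0 by (intro divide_right_mono) auto
  thus "(t - a / 2) * cmod (1 / (of_real t - w)\<^sup>2) \<le> Re (1 / (of_real t - w))"
    unfolding Re_eq by (simp add: B_def norm_divide norm_power)
qed

section \<open>Products and sums over the critical points\<close>

locale lune_points =
  fixes a :: real and N :: nat and w :: "nat \<Rightarrow> complex"
  assumes a_pos: "0 < a" and a_less_1: "a < 1"
    and in_disc: "\<And>j. j < N \<Longrightarrow> cmod (w j) \<le> 1"
    and off_disc: "\<And>j. j < N \<Longrightarrow> 1 < cmod (w j - of_real a)"
begin

definition D :: "complex \<Rightarrow> complex" where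
  "D z = (\<Prod>j<N. (z - w j))"

definition R :: "complex \<Rightarrow> complex" where
  "R z = (\<Sum>j<N. 1 / (z - w j))"

definition R' :: "complex \<Rightarrow> complex" where
  "R' z = - (\<Sum>j<N. 1 / (z - w j)\<^sup>2)"

text \<open>\<open>R\<close> is the logarithmic derivative of \<open>D\<close>, and
  \<open>R'\<close> is the derivative of \<open>R\<close>. Writing \<open>D\<close> as its own
  derivative divided by \<open>R\<close> and integrating by parts leaves \<open>F\<close> as
  boundary term: the derivative of \<open>F\<close> is \<open>D - F * R' / R\<close>.\<close>

definition F :: "complex \<Rightarrow> complex" where
  "F z = D z / R z"

lemma norm_D_a_ge_1: "1 \<le> cmod (D (of_real a))"
proof -
  have "1 \<le> cmod (of_real a - w j)" if "j < N" for j
    using off_disc[OF that] by (simp add: norm_minus_commute)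
  thus ?thesis
    unfolding D_def prod_norm[symmetric] by (intro prod_ge_1) auto
qed

lemma norm_D_le_exp_sum:
  assumes "\<And>j. j < N \<Longrightarrow> (cmod (z - w j))\<^sup>2 \<le> (cmod (z' - w j))\<^sup>2 * exp (- u j)"
  shows "cmod (D z) \<le> cmod (D z') * exp (- ((\<Sum>j<N. u j) / 2))"
proof -
  have "(cmod (D z))\<^sup>2 = (\<Prod>j<N. (cmod (z - w j))\<^sup>2)"
    by (simp add: D_def prod_norm[symmetric] prod_power_distrib)
  also have "\<dots> \<le> (\<Prod>j<N. (cmod (z' - w j))\<^sup>2 * exp (- u j))"
    using assms by (intro prod_mono) auto
  also have "\<dots> = (cmod (D z'))\<^sup>2 * exp (\<Sum>j<N. - u j)"
    by (simp add: D_def prod_norm[symmetric] prod_power_distrib prod.distrib exp_sum)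
  also have "exp (\<Sum>j<N. - u j) = (exp (- ((\<Sum>j<N. u j) / 2)))\<^sup>2"
    by (simp add: exp_double[symmetric] sum_negf)
  finally show ?thesis
    unfolding power_mult_distrib[symmetric] by (rule power2_le_imp_le) auto
qed

lemma norm_D_le:
  assumes "0 \<le> t" "t \<le> a"
  shows "cmod (D (of_real t)) \<le> cmod (D (of_real a)) * exp (- (N * (t * (a - t)) / 2))"
  using norm_D_le_exp_sum[of "of_real t" "of_real a" "\<lambda>_. t * (a - t)"]
    lune_dist_sq_le_exp[OF a_pos a_less_1 in_disc off_disc assms] by simp

text \<open>Meant for \<open>t\<close> near 0, where \<open>norm_D_le\<close> gives no
  decay.\<close>

lemma norm_D_le_centroid:
  assumes "0 \<le> t" "t \<le> a"
  shows "cmod (D (of_real t)) \<le> cmod (D (of_real a))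
    * exp (- ((a - t) * (N * (a + t) - 2 * (\<Sum>j<N. Re (w j))) / 8))"
proof -
  have "(\<Sum>j<N. (a - t) * (a + t - 2 * Re (w j)) / 4)
      = (a - t) * (N * (a + t) - 2 * (\<Sum>j<N. Re (w j))) / 4"
    by (simp add: sum_divide_distrib[symmetric] sum_distrib_left[symmetric] sum_subtractf)
  hence eq: "(\<Sum>j<N. (a - t) * (a + t - 2 * Re (w j)) / 4) / 2
      = (a - t) * (N * (a + t) - 2 * (\<Sum>j<N. Re (w j))) / 8"
    by simp
  show ?thesis
    unfolding eq[symmetric]
    by (rule norm_D_le_exp_sum) (rule lune_dist_sq_le_exp_Re[OF a_pos a_less_1 in_disc off_disc assms])
qed

lemma Re_R_ge:
  assumes "a / 2 \<le> t" "t \<le> a"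
  shows "N * (t - a / 2) \<le> Re (R (of_real t))"
proof -
  have "(\<Sum>j<N. t - a / 2) \<le> (\<Sum>j<N. Re (1 / (of_real t - w j)))"
    using lune_Re_inverse_ge[OF a_pos a_less_1 in_disc off_disc assms]
    by (intro sum_mono) auto
  thus ?thesis
    by (simp add: R_def)
qed

lemma norm_R'_le:
  assumes "a / 2 \<le> t" "t \<le> a"
  shows "(t - a / 2) * cmod (R' (of_real t)) \<le> Re (R (of_real t))"
proof -
  have "(t - a / 2) * cmod (R' (of_real t))
      \<le> (t - a / 2) * (\<Sum>j<N. cmod (1 / (of_real t - w j)\<^sup>2))"
    unfolding R'_def norm_minus_cancel using assms by (intro mult_left_mono norm_sum) auto
  also have "\<dots> = (\<Sum>j<N. (t - a / 2) * cmod (1 / (of_real t - w j)\<^sup>2))"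
    by (rule sum_distrib_left)
  also have "\<dots> \<le> (\<Sum>j<N. Re (1 / (of_real t - w j)))"
    using lune_Re_inverse_ge_norm[OF a_pos a_less_1 in_disc off_disc assms]
    by (intro sum_mono) auto
  finally show ?thesis
    by (simp add: R_def)
qed

lemma diff_nonzero:
  assumes "a / 2 \<le> t" "j < N"
  shows "of_real t - w j \<noteq> 0"
  using lune_Re_less[OF a_pos in_disc off_disc] assms by (force simp: complex_eq_iff)

lemma D_nonzero: "a / 2 \<le> t \<Longrightarrow> D (of_real t) \<noteq> 0"
  using diff_nonzero by (simp add: D_def)

lemma D_has_derivative:
  assumes "a / 2 \<le> t"
  shows "(D has_field_derivative D (of_real t) * R (of_real t)) (at (of_real t))"
proof -
  have "((\<lambda>z. \<Prod>j<N. (z - w j)) has_field_derivative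
      (\<Prod>j<N. (of_real t - w j)) * (\<Sum>j<N. 1 / (of_real t - w j))) (at (of_real t))"
    by (rule has_field_derivative_prod')
      (use diff_nonzero[OF assms] in \<open>auto intro!: derivative_eq_intros\<close>)
  thus ?thesis
    by (simp add: D_def[abs_def] R_def)
qed

lemma R_has_derivative:
  assumes "a / 2 \<le> t"
  shows "(R has_field_derivative R' (of_real t)) (at (of_real t))"
proof -
  have "((\<lambda>z. \<Sum>j<N. 1 / (z - w j)) has_field_derivative
      (\<Sum>j<N. - (1 / (of_real t - w j)\<^sup>2))) (at (of_real t))"
    by (rule DERIV_sum)
      (use diff_nonzero[OF assms] in
        \<open>auto intro!: derivative_eq_intros simp: power2_eq_square\<close>)
  thus ?thesis
    by (simp add: R_def[abs_def] R'_def sum_negf)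
qed

end

text \<open>Here \<open>q\<close> is the logarithmic derivative of \<open>f\<close>, and log |f| has
  derivative \<open>Re q\<close>.\<close>

lemma has_real_derivative_cmod:
  fixes f :: "real \<Rightarrow> complex"
  assumes "(f has_vector_derivative f x * q) (at x)" "f x \<noteq> 0"
  shows "((\<lambda>t. cmod (f t)) has_real_derivative cmod (f x) * Re q) (at x)"
proof -
  have "((\<lambda>t. cmod (f t)) has_derivative (\<lambda>h. inner (h *\<^sub>R (f x * q)) (sgn (f x)))) (at x)"
    using has_derivative_compose[OF assms(1)[unfolded has_vector_derivative_def]
        has_derivative_norm[OF assms(2)]] .
  moreover have "inner (h *\<^sub>R (f x * q)) (sgn (f x)) = cmod (f x) * Re q * h" for h
  proof -
    have "inner (f x * q) (f x) = (cmod (f x))\<^sup>2 * Re q"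
      unfolding cmod_power2 inner_complex_def by (simp add: power2_eq_square algebra_simps)
    hence "inner (f x * q) (sgn (f x)) = cmod (f x) * Re q"
      using assms(2) by (simp add: sgn_div_norm power2_eq_square field_simps)
    thus ?thesis
      by (simp only: inner_scaleR_left mult.commute)
  qed
  ultimately show ?thesis
    unfolding has_field_derivative_def by (simp only:)
qed

section \<open>Growth of |F| on [3a/4, a] and comparison of F with a primitive of D\<close>

context lune_points
begin

text \<open>A lower bound for the logarithmic derivative of \<open>\<bar>F\<bar>\<close> on \<open>[3a/4, a]\<close>.\<close>

definition rate :: real where
  "rate = N * a / 4 - 4 / a"

lemma N_pos:
  assumes "0 < rate"
  shows "0 < N"
  using assms a_pos unfolding rate_def by (cases "N = 0") auto

context
  fixes t :: real
  assumes rate_pos: "0 < rate" and t: "3 * a / 4 \<le> t" "t \<le> a"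
begin

lemma t_bounds: "a / 2 \<le> t" "a / 4 \<le> t - a / 2"
  using t a_pos by auto

lemma Re_R_ge_quarter: "N * a / 4 \<le> Re (R (of_real t))"
proof -
  have "N * (a / 4) \<le> N * (t - a / 2)"
    using t_bounds by (intro mult_left_mono) auto
  thus ?thesis
    using Re_R_ge[of t] t t_bounds by simp
qed

lemma R_nonzero: "R (of_real t) \<noteq> 0"
proof -
  have "0 < N * a / 4"
    using N_pos[OF rate_pos] a_pos by simp
  thus ?thesis
    using Re_R_ge_quarter by auto
qed

lemma F_nonzero: "F (of_real t) \<noteq> 0"
  using R_nonzero D_nonzero t_bounds by (simp add: F_def)

text \<open>The terms of \<open>R'\<close> are dominated by 4/a times the real parts of the terms of
  \<open>R\<close>. Hence the ratio is bounded independently of \<open>N\<close>, whereas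
  \<open>R\<close> grows linearly with \<open>N\<close>.\<close>

lemma norm_R'_R_le: "cmod (R' (of_real t) / R (of_real t)) \<le> 4 / a"
proof -
  have "a / 4 * cmod (R' (of_real t)) \<le> (t - a / 2) * cmod (R' (of_real t))"
    using t_bounds by (intro mult_right_mono) auto
  also have "\<dots> \<le> Re (R (of_real t))"
    using norm_R'_le[of t] t t_bounds by simp
  also have "\<dots> \<le> cmod (R (of_real t))"
    by (rule complex_Re_le_cmod)
  finally show ?thesis
    using R_nonzero a_pos by (simp add: norm_divide field_simps)
qed

lemma Re_logderiv_F_ge:
  "rate \<le> Re (R (of_real t) - R' (of_real t) / R (of_real t))"
proof -
  have "Re (R' (of_real t) / R (of_real t)) \<le> 4 / a"
    using complex_Re_le_cmod norm_R'_R_le by (rule order_trans)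
  thus ?thesis
    using Re_R_ge_quarter by (simp add: rate_def)
qed

lemma F_has_derivative:
  "(F has_field_derivative
    F (of_real t) * (R (of_real t) - R' (of_real t) / R (of_real t))) (at (of_real t))"
proof -
  have "((\<lambda>z. D z / R z) has_field_derivative
      F (of_real t) * (R (of_real t) - R' (of_real t) / R (of_real t))) (at (of_real t))"
    using R_nonzero t_bounds
    by (auto intro!: derivative_eq_intros D_has_derivative R_has_derivative
        simp: F_def field_simps)
  thus ?thesis
    by (simp add: F_def[abs_def])
qed

lemma F_has_vector_derivative:
  "((\<lambda>s. F (of_real s)) has_vector_derivative
    F (of_real t) * (R (of_real t) - R' (of_real t) / R (of_real t))) (at t)"
  using F_has_derivative by (rule has_vector_derivative_real_field)

lemma norm_F_has_derivative:
  "((\<lambda>s. cmod (F (of_real s))) has_real_derivative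
    cmod (F (of_real t)) * Re (R (of_real t) - R' (of_real t) / R (of_real t))) (at t)"
  using F_has_vector_derivative F_nonzero by (rule has_real_derivative_cmod)

lemma norm_F_derivative_ge:
  "rate * cmod (F (of_real t))
    \<le> cmod (F (of_real t)) * Re (R (of_real t) - R' (of_real t) / R (of_real t))"
  using mult_left_mono[OF Re_logderiv_F_ge norm_ge_zero[of "F (of_real t)"]]
  by (simp only: mult.commute)

end

lemma norm_F_mono:
  assumes "0 < rate" "3 * a / 4 \<le> s" "s \<le> t" "t \<le> a"
  shows "cmod (F (of_real s)) \<le> cmod (F (of_real t))"
proof (rule DERIV_nonneg_imp_nondecreasing[OF \<open>s \<le> t\<close>])
  fix x assume x: "s \<le> x" "x \<le> t"
  have "0 \<le> rate * cmod (F (of_real x))"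
    using assms by simp
  also note norm_F_derivative_ge[of x]
  finally show "\<exists>y. ((\<lambda>s. cmod (F (of_real s))) has_real_derivative y) (at x) \<and> 0 \<le> y"
    using norm_F_has_derivative[of x] assms x by fastforce
qed

text \<open>As |F| is nondecreasing, its slope to the right of \<open>s\<close> is at least
  \<open>rate\<close> times its value at \<open>s\<close>. This linear consequence of exponential
  growth is precise enough for the final estimate.\<close>

lemma norm_F_growth:
  assumes "0 < rate" "3 * a / 4 \<le> s" "s \<le> a"
  shows "cmod (F (of_real s)) * (1 + rate * (a - s)) \<le> cmod (F (of_real a))"
proof -
  let ?g = "\<lambda>x. cmod (F (of_real x)) - rate * cmod (F (of_real s)) * x"
  have "?g s \<le> ?g a"
  proof (rule DERIV_nonneg_imp_nondecreasing[OF \<open>s \<le> a\<close>])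
    fix x assume x: "s \<le> x" "x \<le> a"
    let ?d = "cmod (F (of_real x)) * Re (R (of_real x) - R' (of_real x) / R (of_real x))"
    have "rate * cmod (F (of_real s)) \<le> rate * cmod (F (of_real x))"
      using assms x by (intro mult_left_mono norm_F_mono) auto
    also have "\<dots> \<le> ?d"
      using assms x by (intro norm_F_derivative_ge) auto
    finally have "0 \<le> ?d - rate * cmod (F (of_real s))"
      by simp
    moreover have "(?g has_real_derivative ?d - rate * cmod (F (of_real s))) (at x)"
      using assms x by (auto intro!: derivative_eq_intros norm_F_has_derivative)
    ultimately show "\<exists>y. (?g has_real_derivative y) (at x) \<and> 0 \<le> y"
      by blast
  qed
  thus ?thesis
    by (simp add: algebra_simps)
qed

text \<open>The derivative of \<open>Q - F\<close> is \<open>F * R' / R\<close>, of modulus at most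
  4/a times |F|, and |F| is at most 1/\<open>rate\<close> times its own derivative. The mean value
  inequality with a multiple of |F| as majorant then gives the bound.\<close>

lemma primitive_minus_F_le:
  assumes "0 < rate" "3 * a / 4 \<le> t" "t \<le> a"
    and Q: "\<And>z. (Q has_field_derivative D z) (at z)"
  shows "cmod ((Q (of_real t) - F (of_real t)) - (Q (of_real (3 * a / 4)) - F (of_real (3 * a / 4))))
    \<le> 4 / (a * rate) * (cmod (F (of_real t)) - cmod (F (of_real (3 * a / 4))))"
proof (cases "3 * a / 4 = t")
  case False
  let ?q = "\<lambda>x. R (of_real x) - R' (of_real x) / R (of_real x)"
  let ?f = "\<lambda>x. Q (of_real x) - F (of_real x)"
  let ?f' = "\<lambda>x. D (of_real x) - F (of_real x) * ?q x"
  let ?g = "\<lambda>x. 4 / (a * rate) * cmod (F (of_real x))"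
  let ?g' = "\<lambda>x. 4 / (a * rate) * (cmod (F (of_real x)) * Re (?q x))"
  have f': "(?f has_vector_derivative ?f' x) (at x)" if "3 * a / 4 \<le> x" "x \<le> t" for x
    using that assms
    by (intro has_vector_derivative_diff has_vector_derivative_real_field[OF Q]
        F_has_vector_derivative) auto
  have g': "(?g has_real_derivative ?g' x) (at x)" if "3 * a / 4 \<le> x" "x \<le> t" for x
    using that assms by (intro DERIV_cmult norm_F_has_derivative) auto
  have "cmod (?f t - ?f (3 * a / 4)) \<le> ?g t - ?g (3 * a / 4)"
  proof (rule differentiable_bound_general[where f' = ?f' and \<phi>' = ?g'])
    show "3 * a / 4 < t"
      using False assms by simp
    show "continuous_on {3 * a / 4..t} ?f"
      by (auto intro!: continuous_at_imp_continuous_on has_vector_derivative_continuous[OF f'])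
    show "continuous_on {3 * a / 4..t} ?g"
      by (intro continuous_at_imp_continuous_on ballI DERIV_isCont[OF g']) auto
  next
    fix x assume x: "3 * a / 4 < x" "x < t"
    show "(?f has_vector_derivative ?f' x) (at x)"
      using f' x by simp
    show "(?g has_vector_derivative ?g' x) (at x)"
      using g' x by (simp add: has_real_derivative_iff_has_vector_derivative)
    have "R (of_real x) \<noteq> 0"
      using x assms by (intro R_nonzero) auto
    hence "?f' x = F (of_real x) * (R' (of_real x) / R (of_real x))"
      by (simp add: F_def algebra_simps)
    hence "cmod (?f' x) = cmod (F (of_real x)) * cmod (R' (of_real x) / R (of_real x))"
      by (simp only: norm_mult)
    also have "\<dots> \<le> cmod (F (of_real x)) * (4 / a)"
      using x assms by (intro mult_left_mono norm_R'_R_le) auto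
    also have "\<dots> = 4 / (a * rate) * (rate * cmod (F (of_real x)))"
      using assms(1) by simp
    also have "\<dots> \<le> ?g' x"
      using x assms a_pos by (intro mult_left_mono norm_F_derivative_ge) auto
    finally show "cmod (?f' x) \<le> ?g' x" .
  qed
  thus ?thesis
    by (simp add: right_diff_distrib)
qed simp

end

lemma norm_diff_le_on_real_segment:
  fixes f f' :: "complex \<Rightarrow> complex" and s t :: real
  assumes "\<And>z. (f has_field_derivative f' z) (at z)"
    and "s \<le> t" and B: "\<And>x. s \<le> x \<Longrightarrow> x \<le> t \<Longrightarrow> cmod (f' (of_real x)) \<le> B"
  shows "cmod (f (of_real t) - f (of_real s)) \<le> B * (t - s)"
proof -
  have "cmod (f (of_real t) - f (of_real s)) \<le> B * cmod (of_real t - of_real s)"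
  proof (rule field_differentiable_bound[where S = "closed_segment (of_real s) (of_real t)"])
    show "(f has_field_derivative f' z) (at z within closed_segment (of_real s) (of_real t))" for z
      using assms(1) by (rule has_field_derivative_at_within)
  next
    fix z :: complex assume "z \<in> closed_segment (of_real s) (of_real t)"
    then obtain x where "z = of_real x" "s \<le> x" "x \<le> t"
      using \<open>s \<le> t\<close> by (auto simp: closed_segment_of_real closed_segment_eq_real_ivl)
    thus "cmod (f' z) \<le> B"
      using B by simp
  qed auto
  also have "cmod (of_real t - of_real s) = t - s"
    using \<open>s \<le> t\<close> by (simp flip: of_real_diff)
  finally show ?thesis .
qed

section \<open>Estimates for the polynomial\<close>

text \<open>\<open>P\<close> has degree \<open>Suc N\<close>. Its zeros enter through
  \<open>P_0\<close> and \<open>norm_P_le_centroid\<close>; in the latter their centroid is already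
  expressed by the critical points.\<close>

locale sendov_counterexample = lune_points +
  fixes P :: "complex \<Rightarrow> complex"
  assumes P_has_derivative: "\<And>z. (P has_field_derivative of_nat (Suc N) * D z) (at z)"
    and P_a: "P (of_real a) = 0"
    and P_0: "cmod (P 0) \<le> a"
    and norm_P_le_centroid: "\<And>x. cmod (P (of_real x))
      \<le> exp (real (Suc N) * (x\<^sup>2 / 2 - x * ((\<Sum>j<N. Re (w j)) / N)))"
    and N_ge: "9 * ((4 + 2 * a) / a)\<^sup>2 \<le> real (Suc N)"
    and N_ge_ln: "32 * ln (40 / a\<^sup>2) / a\<^sup>2 \<le> real (Suc N)"
begin

definition M :: real where "M = cmod (D (of_real a))"

definition k :: real where "k = N * a\<^sup>2"

text \<open>The unit of decay: relative to \<open>M\<close>, the modulus of \<open>D\<close> will be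
  at most \<open>e ^ 3\<close> on [a/4, 3a/4] and, for a centroid with small real part, at most
  \<open>e\<^sup>2\<close> on [0, a/4].\<close>

definition e :: real where "e = exp (- (k / 32))"

text \<open>The constant \<open>4 / (a * rate)\<close> of \<open>primitive_minus_F_le\<close>, that
  is, the relative error of the approximation by \<open>F\<close>.\<close>

definition \<epsilon> :: real where "\<epsilon> = 16 / (k - 16)"

section \<open>Numerical consequences of the lower bounds on the degree\<close>

lemma M_ge_1: "1 \<le> M"
  unfolding M_def by (rule norm_D_a_ge_1)

lemma a_sq: "0 < a\<^sup>2" "a\<^sup>2 < 1"
  using a_pos a_less_1 by (auto simp: power_less_one_iff)

lemma Suc_N_a_sq: "real (Suc N) * a\<^sup>2 = k + a\<^sup>2"
  by (simp add: k_def algebra_simps)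

lemma k_ge: "144 + 144 * a \<le> k"
proof -
  have "9 * ((4 + 2 * a) / a)\<^sup>2 * a\<^sup>2 \<le> real (Suc N) * a\<^sup>2"
    using N_ge by (rule mult_right_mono) simp
  moreover have "9 * ((4 + 2 * a) / a)\<^sup>2 * a\<^sup>2 = 144 + 144 * a + 36 * a\<^sup>2"
    using a_pos by (simp add: field_simps power2_eq_square)
  ultimately show ?thesis
    using a_sq Suc_N_a_sq by linarith
qed

lemma N_ge_144: "144 \<le> real N"
proof -
  have "k \<le> real N * 1"
    unfolding k_def using a_sq by (intro mult_left_mono) auto
  thus ?thesis
    using k_ge a_pos by linarith
qed

lemma e_pos: "0 < e"
  by (simp add: e_def)

lemma e_pow: "exp (- (2 * k / 32)) = e\<^sup>2" "exp (- (3 * k / 32)) = e ^ 3"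
  by (simp_all add: e_def exp_of_nat_mult[symmetric])

lemma exp_Suc_N_le: "exp (- (real (Suc N) * a\<^sup>2 / 32)) \<le> a\<^sup>2 / 40"
proof -
  have "32 * ln (40 / a\<^sup>2) \<le> real (Suc N) * a\<^sup>2"
    using N_ge_ln a_sq(1) by (simp add: field_simps)
  hence "exp (- (real (Suc N) * a\<^sup>2 / 32)) \<le> exp (- ln (40 / a\<^sup>2))"
    by simp
  also have "\<dots> = a\<^sup>2 / 40"
    using a_sq(1) by (simp add: exp_minus)
  finally show ?thesis .
qed

text \<open>Replacing \<open>Suc N\<close> by \<open>N\<close> in the exponent costs a factor
  exp(a^2/32), which is at most 40/38.\<close>

lemma e_le: "e \<le> a\<^sup>2 / 38"
proof -
  have "exp (1 / 32 :: real) * (1 + - (1 / 32)) \<le> exp (1 / 32) * exp (- (1 / 32))"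
    by (intro mult_left_mono exp_ge_add_one_self) auto
  hence e32: "exp (1 / 32 :: real) \<le> 40 / 38"
    by (simp flip: exp_add)
  have "e = exp (- (real (Suc N) * a\<^sup>2 / 32)) * exp (a\<^sup>2 / 32)"
    unfolding e_def Suc_N_a_sq by (simp flip: exp_add add: field_simps)
  also have "\<dots> \<le> a\<^sup>2 / 40 * exp (1 / 32)"
    using exp_Suc_N_le a_sq by (intro mult_mono) auto
  also have "\<dots> \<le> a\<^sup>2 / 40 * (40 / 38)"
    using e32 by (intro mult_left_mono) auto
  finally show ?thesis
    by simp
qed

lemma e_le': "e \<le> 1 / 38"
  using e_le a_sq by simp

lemma k_e_le: "(k + 1) * e \<le> 2"
proof -
  \<comment> \<open>The exponential of \<open>k / 32\<close> is bounded below by a line through the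
    point k = 144, where \<open>k / 32 = 9 / 2\<close>. The value 145/2 needed there comes from the
    ninth power of 13/8.\<close>
  have "(13 / 8 :: real) \<le> exp (1 / 2)"
    using exp_lower_Taylor_quadratic[of "1 / 2 :: real"] by (simp add: power2_eq_square)
  hence "(13 / 8 :: real) ^ 9 \<le> exp (1 / 2) ^ 9"
    by (intro power_mono) auto
  also have "exp (1 / 2) ^ 9 = exp (9 / 2 :: real)"
    by (simp flip: exp_of_nat_mult)
  finally have "145 / 2 \<le> exp (9 / 2 :: real)"
    by (simp add: power_divide)
  hence "145 / 2 * (1 + (k / 32 - 9 / 2)) \<le> exp (9 / 2) * exp (k / 32 - 9 / 2)"
    using k_ge a_pos by (intro mult_mono exp_ge_add_one_self) auto
  also have "\<dots> = exp (k / 32)"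
    by (simp flip: exp_add)
  finally have "k + 1 \<le> 2 * exp (k / 32)"
    using k_ge a_pos by (simp add: field_simps)
  hence "(k + 1) * e \<le> 2 * exp (k / 32) * e"
    using e_pos by (intro mult_right_mono) auto
  thus ?thesis
    by (simp add: e_def mult.assoc flip: exp_add)
qed

text \<open>One factor \<open>e\<close> absorbs \<open>k + 1\<close>; the other supplies the
  \<open>a\<^sup>2\<close> by which \<open>Suc N\<close> differs from the quantity of size
  \<open>k\<close>.\<close>

lemma Suc_N_e_sq_le: "real (Suc N) * e\<^sup>2 \<le> 1 / 19"
proof -
  have "real (Suc N) * e\<^sup>2 * a\<^sup>2 = (k + a\<^sup>2) * e * e"
    using Suc_N_a_sq by (simp add: power2_eq_square mult_ac)
  also have "\<dots> \<le> (k + 1) * e * e"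
    using a_sq e_pos by (intro mult_right_mono) auto
  also have "\<dots> \<le> 2 * e"
    using k_e_le e_pos by (intro mult_right_mono) auto
  also have "\<dots> \<le> 1 / 19 * a\<^sup>2"
    using e_le by simp
  finally show ?thesis
    using a_sq(1) by (simp only: mult_le_cancel_right_pos)
qed

lemma Suc_N_e_cube_le: "real (Suc N) * e ^ 3 \<le> 1 / 722"
proof -
  have "real (Suc N) * e ^ 3 = real (Suc N) * e\<^sup>2 * e"
    by (simp add: power2_eq_square power3_eq_cube)
  also have "\<dots> \<le> 1 / 19 * (1 / 38)"
    using Suc_N_e_sq_le e_le' e_pos by (intro mult_mono) auto
  finally show ?thesis
    by simp
qed

lemma rate_eq: "rate = (k - 16) / (4 * a)"
  using a_pos by (simp add: rate_def k_def field_simps power2_eq_square)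

lemma rate_pos: "0 < rate"
  unfolding rate_eq using k_ge a_pos by simp

lemma \<epsilon>_eq: "4 / (a * rate) = \<epsilon>"
  unfolding rate_eq \<epsilon>_def using a_pos by simp

section \<open>Near-constancy of P on [0, 3a/4]\<close>

lemma norm_D_middle_le:
  assumes "a / 4 \<le> t" "t \<le> 3 * a / 4"
  shows "cmod (D (of_real t)) \<le> M * e ^ 3"
proof -
  \<comment> \<open>The concave function \<open>t * (a - t)\<close> takes its minimum over the
    interval at the two ends, with value 3a^2/16.\<close>
  have "0 \<le> (t - a / 4) * (3 * a / 4 - t)"
    using assms by (intro mult_nonneg_nonneg) auto
  hence "3 * a\<^sup>2 / 16 \<le> t * (a - t)"
    by (simp add: power2_eq_square field_simps)
  hence "N * (3 * a\<^sup>2 / 16) \<le> N * (t * (a - t))"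
    by (intro mult_left_mono) auto
  hence "exp (- (N * (t * (a - t)) / 2)) \<le> e ^ 3"
    unfolding e_pow[symmetric] by (simp add: k_def)
  hence "M * exp (- (N * (t * (a - t)) / 2)) \<le> M * e ^ 3"
    using M_ge_1 by (intro mult_left_mono) auto
  thus ?thesis
    using norm_D_le[of t] assms a_pos by (simp add: M_def)
qed

lemma norm_D_left_le:
  assumes "(\<Sum>j<N. Re (w j)) / N \<le> a / 4" "0 \<le> t" "t \<le> a / 4"
  shows "cmod (D (of_real t)) \<le> M * e\<^sup>2"
proof -
  \<comment> \<open>With the centroid at its extreme value a/4 the exponent contains
    \<open>(a - t) * (a / 2 + t)\<close>, which exceeds its value at 0 by half of this
    product.\<close>
  have "t * (a - 2 * t) \<ge> 0"
    using assms by (intro mult_nonneg_nonneg) auto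
  hence "a\<^sup>2 / 2 \<le> (a - t) * (a / 2 + t)"
    by (simp add: power2_eq_square field_simps)
  hence "N * (a\<^sup>2 / 2) \<le> N * ((a - t) * (a / 2 + t))"
    by (intro mult_left_mono) auto
  also have "\<dots> = (a - t) * (N * (a + t) - 2 * (N * (a / 4)))"
    by (simp add: algebra_simps)
  also have "\<dots> \<le> (a - t) * (N * (a + t) - 2 * (\<Sum>j<N. Re (w j)))"
    using assms a_pos N_ge_144 by (intro mult_left_mono) (auto simp: field_simps)
  finally have "exp (- ((a - t) * (N * (a + t) - 2 * (\<Sum>j<N. Re (w j))) / 8)) \<le> e\<^sup>2"
    unfolding e_pow[symmetric] by (simp add: k_def)
  hence "M * exp (- ((a - t) * (N * (a + t) - 2 * (\<Sum>j<N. Re (w j))) / 8)) \<le> M * e\<^sup>2"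
    using M_ge_1 by (intro mult_left_mono) auto
  thus ?thesis
    using norm_D_le_centroid[of t] assms a_pos by (simp add: M_def)
qed

lemma norm_P_diff_le:
  assumes "s \<le> t" "\<And>x. s \<le> x \<Longrightarrow> x \<le> t \<Longrightarrow> cmod (D (of_real x)) \<le> B"
  shows "cmod (P (of_real t) - P (of_real s)) \<le> real (Suc N) * B * (t - s)"
proof (rule norm_diff_le_on_real_segment[OF P_has_derivative \<open>s \<le> t\<close>])
  show "cmod (of_nat (Suc N) * D (of_real x)) \<le> real (Suc N) * B" if "s \<le> x" "x \<le> t" for x
    unfolding norm_mult norm_of_nat using assms(2)[OF that] by (intro mult_left_mono) auto
qed

lemma norm_P_diff_middle_le:
  assumes "a / 4 \<le> s" "s \<le> t" "t \<le> 3 * a / 4"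
  shows "cmod (P (of_real t) - P (of_real s)) \<le> M / 722"
proof -
  have "cmod (P (of_real t) - P (of_real s)) \<le> real (Suc N) * (M * e ^ 3) * (t - s)"
    using assms by (intro norm_P_diff_le norm_D_middle_le) auto
  also have "\<dots> \<le> real (Suc N) * (M * e ^ 3) * 1"
    using assms a_less_1 a_pos M_ge_1 e_pos by (intro mult_left_mono) auto
  also have "\<dots> = M * (real (Suc N) * e ^ 3)"
    by simp
  also have "\<dots> \<le> M * (1 / 722)"
    using M_ge_1 Suc_N_e_cube_le by (intro mult_left_mono) auto
  finally show ?thesis
    by simp
qed

lemma norm_P_diff_left_le:
  assumes "(\<Sum>j<N. Re (w j)) / N \<le> a / 4" "0 \<le> t" "t \<le> a / 4"
  shows "cmod (P (of_real t) - P 0) \<le> M / 76"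
proof -
  have "cmod (P (of_real t) - P (of_real 0)) \<le> real (Suc N) * (M * e\<^sup>2) * (t - 0)"
    using assms by (intro norm_P_diff_le norm_D_left_le) auto
  also have "\<dots> \<le> real (Suc N) * (M * e\<^sup>2) * (1 / 4)"
    using assms a_less_1 a_pos M_ge_1 e_pos by (intro mult_left_mono) auto
  also have "\<dots> = M * (real (Suc N) * e\<^sup>2) * (1 / 4)"
    by simp
  also have "\<dots> \<le> M * (1 / 19) * (1 / 4)"
    using M_ge_1 Suc_N_e_sq_le by (intro mult_left_mono mult_right_mono) auto
  finally show ?thesis
    by simp
qed

section \<open>Comparison of P with P'/R on [3a/4, a]\<close>

lemma norm_R_a_le: "cmod (R (of_real a)) \<le> N"
proof -
  have "cmod (R (of_real a)) \<le> (\<Sum>j<N. cmod (1 / (of_real a - w j)))"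
    unfolding R_def by (rule norm_sum)
  also have "\<dots> \<le> (\<Sum>j<N. 1)"
    using off_disc
    by (intro sum_mono) (auto simp: norm_divide norm_minus_commute divide_le_eq_1 less_imp_le)
  finally show ?thesis
    by simp
qed

text \<open>This is |P'/R| at \<open>t\<close>, the size of the boundary term for
  \<open>P\<close>.\<close>

definition G :: "real \<Rightarrow> real" where
  "G t = real (Suc N) * cmod (F (of_real t))"

lemma M_le_G_a: "M \<le> G a"
proof -
  have R0: "R (of_real a) \<noteq> 0"
    using rate_pos a_pos by (intro R_nonzero) auto
  have "M * cmod (R (of_real a)) \<le> M * real (Suc N)"
    using norm_R_a_le M_ge_1 by (intro mult_left_mono) auto
  thus ?thesis
    using R0 by (simp add: G_def F_def norm_divide M_def field_simps)
qed

lemma G_left_le: "G (3 * a / 4) \<le> M / 684"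
proof -
  have "N * a / 4 \<le> Re (R (of_real (3 * a / 4)))"
    using rate_pos a_pos by (intro Re_R_ge_quarter) auto
  hence R: "N * a / 4 \<le> cmod (R (of_real (3 * a / 4)))"
    using complex_Re_le_cmod order_trans by blast
  have "cmod (D (of_real (3 * a / 4))) \<le> M * e ^ 3"
    using a_pos by (intro norm_D_middle_le) auto
  hence "G (3 * a / 4) \<le> real (Suc N) * (M * e ^ 3 / (N * a / 4))"
    unfolding G_def F_def norm_divide using R N_ge_144 a_pos M_ge_1 e_pos
    by (intro mult_left_mono frac_le) auto
  also have "\<dots> = (real (Suc N) * e ^ 3) * (M * (4 * a / k))"
    using a_pos by (simp add: k_def power2_eq_square)
  also have "\<dots> \<le> 1 / 722 * (M * (1 / 36))"
  proof -
    have "4 * a / k \<le> 1 / 36"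
      using k_ge a_pos by (simp add: field_simps)
    thus ?thesis
      using Suc_N_e_cube_le M_ge_1 e_pos a_pos k_ge
      by (intro mult_mono mult_left_mono) auto
  qed
  also have "\<dots> \<le> M / 684"
    using M_ge_1 by simp
  finally show ?thesis .
qed

lemma G_nonneg: "0 \<le> G t"
  by (simp add: G_def)

lemma P_minus_F_le:
  assumes "3 * a / 4 \<le> t" "t \<le> a"
  shows "cmod ((P (of_real t) - of_nat (Suc N) * F (of_real t))
      - (P (of_real (3 * a / 4)) - of_nat (Suc N) * F (of_real (3 * a / 4))))
    \<le> \<epsilon> * (G t - G (3 * a / 4))"
proof -
  define Q where "Q z = P z / of_nat (Suc N)" for z
  have PQ: "P z = of_nat (Suc N) * Q z" for z
    unfolding Q_def by (simp del: of_nat_Suc)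
  have "((\<lambda>z. P z / of_nat (Suc N)) has_field_derivative
      of_nat (Suc N) * D z / of_nat (Suc N)) (at z)" for z
    by (intro DERIV_cdivide P_has_derivative)
  hence "(Q has_field_derivative D z) (at z)" for z
    unfolding Q_def[abs_def] by (simp del: of_nat_Suc)
  from primitive_minus_F_le[OF rate_pos assms this]
  have "real (Suc N) * cmod ((Q (of_real t) - F (of_real t)) - (Q (of_real (3 * a / 4)) - F (of_real (3 * a / 4))))
    \<le> real (Suc N) * (\<epsilon> * (cmod (F (of_real t)) - cmod (F (of_real (3 * a / 4)))))"
    unfolding \<epsilon>_eq by (intro mult_left_mono) auto
  also have "real (Suc N) * cmod ((Q (of_real t) - F (of_real t)) - (Q (of_real (3 * a / 4)) - F (of_real (3 * a / 4))))
    = cmod (of_nat (Suc N) * ((Q (of_real t) - F (of_real t)) - (Q (of_real (3 * a / 4)) - F (of_real (3 * a / 4)))))"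
    by (simp only: norm_mult norm_of_nat)
  finally show ?thesis
    unfolding PQ G_def by (simp only: algebra_simps)
qed

text \<open>At \<open>t = a\<close> the comparison has \<open>P\<close> equal to 0, so the plateau
  value must nearly cancel the boundary term at \<open>a\<close>.\<close>

lemma norm_P_left_ge:
  "(1 - \<epsilon>) * (G a - G (3 * a / 4)) \<le> cmod (P (of_real (3 * a / 4)))"
proof -
  let ?t = "of_real (3 * a / 4) :: complex" and ?n = "of_nat (Suc N) :: complex"
  have "G a \<le> cmod ((P (of_real a) - ?n * F (of_real a)) - (P ?t - ?n * F ?t)) + cmod (P ?t - ?n * F ?t)"
    using norm_triangle_ineq[of "(P (of_real a) - ?n * F (of_real a)) - (P ?t - ?n * F ?t)" "P ?t - ?n * F ?t"]
    by (simp add: P_a G_def norm_mult del: of_nat_Suc)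
  also have "cmod (P ?t - ?n * F ?t) \<le> cmod (P ?t) + G (3 * a / 4)"
    using norm_triangle_ineq4[of "P ?t" "?n * F ?t"] by (simp only: G_def norm_mult norm_of_nat)
  finally show ?thesis
    using P_minus_F_le[of a] a_pos by (simp add: algebra_simps)
qed

lemma norm_P_right_le:
  assumes "3 * a / 4 \<le> t" "t \<le> a"
  shows "cmod (P (of_real t)) \<le> cmod (P (of_real (3 * a / 4))) + (1 + \<epsilon>) * G t + G (3 * a / 4)"
proof -
  let ?s = "of_real (3 * a / 4) :: complex" and ?t = "of_real t :: complex"
    and ?n = "of_nat (Suc N) :: complex"
  have "P ?t = ((P ?t - ?n * F ?t) - (P ?s - ?n * F ?s)) + ((P ?s - ?n * F ?s) + ?n * F ?t)"
    by simp
  also have "cmod \<dots> \<le> cmod ((P ?t - ?n * F ?t) - (P ?s - ?n * F ?s))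
      + ((cmod (P ?s) + cmod (?n * F ?s)) + cmod (?n * F ?t))"
    by (intro norm_triangle_le add_mono order_refl norm_triangle_le_diff)
  also have "\<dots> \<le> \<epsilon> * (G t - G (3 * a / 4)) + ((cmod (P ?s) + G (3 * a / 4)) + G t)"
    using P_minus_F_le[OF assms] by (simp only: G_def norm_mult norm_of_nat)
  also have "\<dots> \<le> cmod (P ?s) + (1 + \<epsilon>) * G t + G (3 * a / 4)"
  proof -
    have "0 \<le> \<epsilon> * G (3 * a / 4)"
      using k_ge a_pos by (simp add: \<epsilon>_def G_nonneg)
    thus ?thesis
      by (simp add: algebra_simps)
  qed
  finally show ?thesis .
qed

lemma \<epsilon>_bounds: "0 \<le> \<epsilon>" "\<epsilon> \<le> 1 / 8"
  using k_ge a_pos by (auto simp: \<epsilon>_def field_simps)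

section \<open>The centroid, the lower bound on a, and the conclusion\<close>

lemma centroid_less: "(\<Sum>j<N. Re (w j)) / N < a / 4"
proof (rule ccontr)
  define \<mu> where "\<mu> = (\<Sum>j<N. Re (w j)) / N"
  assume "\<not> (\<Sum>j<N. Re (w j)) / N < a / 4"
  hence \<mu>: "a / 4 \<le> \<mu>"
    by (simp add: \<mu>_def)
  \<comment> \<open>The upper bound a/2 keeps \<open>\<mu>\<close> in the range where
    \<open>P\<close> is almost constant, so smallness of \<open>P\<close> at \<open>\<mu>\<close>
    carries over to 3a/4.\<close>
  have "(\<Sum>j<N. Re (w j)) \<le> (\<Sum>j<N. a / 2)"
    using lune_Re_less[OF a_pos in_disc off_disc] by (intro sum_mono) (auto intro: less_imp_le)
  hence \<mu>_le: "\<mu> \<le> a / 2"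
    using N_ge_144 by (simp add: \<mu>_def field_simps)
  have "(a / 4)\<^sup>2 \<le> \<mu>\<^sup>2"
    using \<mu> a_pos by (intro power_mono) auto
  hence "real (Suc N) * (a\<^sup>2 / 16) \<le> real (Suc N) * \<mu>\<^sup>2"
    by (intro mult_left_mono) (auto simp: power_divide)
  hence "exp (real (Suc N) * (\<mu>\<^sup>2 / 2 - \<mu> * \<mu>)) \<le> exp (- (real (Suc N) * a\<^sup>2 / 32))"
    by (simp add: power2_eq_square algebra_simps)
  hence "cmod (P (of_real \<mu>)) \<le> 1 / 40"
    using norm_P_le_centroid[of \<mu>, folded \<mu>_def] exp_Suc_N_le a_sq by linarith
  moreover have "cmod (P (of_real (3 * a / 4)) - P (of_real \<mu>)) \<le> M / 722"
    using \<mu> \<mu>_le a_pos by (intro norm_P_diff_middle_le) auto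
  ultimately have "cmod (P (of_real (3 * a / 4))) \<le> 1 / 40 + M / 722"
    using norm_triangle_sub[of "P (of_real (3 * a / 4))" "P (of_real \<mu>)"] by linarith
  moreover have "7 / 8 * (M - M / 684) \<le> (1 - \<epsilon>) * (G a - G (3 * a / 4))"
    using \<epsilon>_bounds M_le_G_a G_left_le M_ge_1 by (intro mult_mono) auto
  ultimately show False
    using norm_P_left_ge M_ge_1 by simp
qed

lemma norm_P_left_le:
  assumes "0 \<le> t" "t \<le> 3 * a / 4"
  shows "cmod (P (of_real t)) \<le> a + M / 60"
proof -
  have *: "cmod (P (of_real s)) \<le> a + M / 76" if "0 \<le> s" "s \<le> a / 4" for s
    using norm_P_diff_left_le[OF less_imp_le[OF centroid_less] that] P_0
      norm_triangle_sub[of "P (of_real s)" "P 0"] by linarith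
  show ?thesis
  proof (cases "t \<le> a / 4")
    case True
    thus ?thesis
      using *[of t] assms M_ge_1 by auto
  next
    case False
    hence "cmod (P (of_real t) - P (of_real (a / 4))) \<le> M / 722"
      using assms by (intro norm_P_diff_middle_le) auto
    thus ?thesis
      using *[of "a / 4"] a_pos M_ge_1
        norm_triangle_sub[of "P (of_real t)" "P (of_real (a / 4))"] by linarith
  qed
qed

lemma G_a_bound: "(1 - \<epsilon>) * (G a - M / 684) \<le> a + M / 60"
proof -
  have "(1 - \<epsilon>) * (G a - M / 684) \<le> (1 - \<epsilon>) * (G a - G (3 * a / 4))"
    using \<epsilon>_bounds G_left_le by (intro mult_left_mono) auto
  also note norm_P_left_ge
  also have "cmod (P (of_real (3 * a / 4))) \<le> a + M / 60"
    using a_pos by (intro norm_P_left_le) auto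
  finally show ?thesis .
qed

text \<open>The plateau value is at least about 7/8 of \<open>M\<close>, hence about 7/8, and at
  most \<open>a + M / 60\<close>. A large \<open>a\<close> in turn improves the bounds on
  \<open>k\<close> and \<open>\<epsilon>\<close>.\<close>

lemma a_ge: "17 / 20 \<le> a"
proof -
  have "7 / 8 * (M - M / 684) \<le> (1 - \<epsilon>) * (G a - M / 684)"
    using \<epsilon>_bounds M_le_G_a M_ge_1 by (intro mult_mono) auto
  with G_a_bound have "7 / 8 * (M - M / 684) \<le> a + M / 60"
    by linarith
  thus ?thesis
    using M_ge_1 by simp
qed

lemma k_ge': "266 \<le> k"
  using k_ge a_ge by simp

lemma \<epsilon>_le: "\<epsilon> \<le> 8 / 125"
  using k_ge' by (simp add: \<epsilon>_def field_simps)

lemma G_a_bound': "117 / 125 * (G a - M / 684) \<le> a + M / 60"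
proof -
  have "117 / 125 * (G a - M / 684) \<le> (1 - \<epsilon>) * (G a - M / 684)"
    using \<epsilon>_le M_le_G_a M_ge_1 by (intro mult_right_mono) auto
  thus ?thesis
    using G_a_bound by linarith
qed

lemma M_le: "M \<le> 109 / 100 * a"
  using G_a_bound' M_le_G_a a_pos by simp

lemma G_a_le: "G a \<le> 109 / 100"
  using G_a_bound' M_le a_less_1 by simp

theorem norm_P_le:
  assumes "0 < c" "c < a"
  shows "cmod (P (of_real c)) \<le> 1 + a"
proof (cases "c \<le> 3 * a / 4")
  case True
  have "a + M / 60 \<le> a + 1"
    using M_le a_less_1 by simp
  thus ?thesis
    using norm_P_left_le[of c] True assms by simp
next
  case False
  show ?thesis
  \<comment> \<open>The threshold has to serve both cases. Near \<open>a\<close>, the mean value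
    bound needs 183/100 times 109/100 to be below 2; farther away, 183/100 times 183/1000 exceeds
    1/3, which makes \<open>G c\<close> at most 3/4 of \<open>G a\<close>.\<close>
  proof (cases "real (Suc N) * (a - c) \<le> 183 / 100")
    case True
    have D_le: "cmod (D (of_real x)) \<le> M" if "c \<le> x" "x \<le> a" for x
    proof -
      have "M * exp (- (N * (x * (a - x)) / 2)) \<le> M * 1"
        using M_ge_1 that assms by (intro mult_left_mono) auto
      thus ?thesis
        using norm_D_le[of x] that assms by (simp add: M_def)
    qed
    have "cmod (P (of_real a) - P (of_real c)) \<le> real (Suc N) * M * (a - c)"
      using assms D_le by (intro norm_P_diff_le) auto
    hence "cmod (P (of_real c)) \<le> M * (real (Suc N) * (a - c))"
      by (simp add: P_a mult_ac)
    also have "\<dots> \<le> M * (183 / 100)"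
      using True M_ge_1 by (intro mult_left_mono) auto
    also have "\<dots> \<le> 1 + a"
      using M_le a_less_1 by simp
    finally show ?thesis .
  next
    case far: False
    have c: "3 * a / 4 \<le> c" "c \<le> a"
      using False assms by auto
    have "k \<le> real N * 1"
      unfolding k_def using a_sq by (intro mult_left_mono) auto
    moreover have "real N * (17 / 20) / 4 \<le> real N * a / 4"
      using a_ge by (intro divide_right_mono mult_left_mono) auto
    moreover have "4 / a \<le> 5"
      using a_ge by (simp add: field_simps)
    ultimately have "real (Suc N) * (183 / 1000) \<le> real N * (17 / 20) / 4 - 5"
      and "real N * (17 / 20) / 4 - 5 \<le> rate"
      unfolding rate_def using k_ge' by (simp, intro diff_mono)
    hence "real (Suc N) * (183 / 1000) \<le> rate"
      by (rule order_trans)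
    hence "real (Suc N) * (183 / 1000) * (a - c) \<le> rate * (a - c)"
      using assms by (intro mult_right_mono) auto
    moreover have "1 / 3 \<le> (real (Suc N) * (a - c)) * (183 / 1000)"
      using far by linarith
    ultimately have "1 / 3 \<le> rate * (a - c)"
      by (simp only: mult_ac)
    hence "G c * (1 + 1 / 3) \<le> G c * (1 + rate * (a - c))"
      using G_nonneg by (intro mult_left_mono) auto
    also have "\<dots> \<le> G a"
      unfolding G_def mult.assoc
      using norm_F_growth[OF rate_pos c] by (intro mult_left_mono) auto
    finally have "G c \<le> 82 / 100"
      using G_a_le by simp
    hence "(1 + \<epsilon>) * G c \<le> (1 + 8 / 125) * (82 / 100)"
      using \<epsilon>_le G_nonneg by (intro mult_mono) auto
    moreover have "cmod (P (of_real (3 * a / 4))) \<le> a + M / 60"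
      using a_pos by (intro norm_P_left_le) auto
    ultimately show ?thesis
      using norm_P_right_le[OF c] G_left_le M_le a_less_1 by simp
  qed
qed

end

section \<open>Zeros and critical points\<close>

lemma
  fixes r :: "nat \<Rightarrow> complex"
  shows coeff_prod_linear_lead: "coeff (\<Prod>j<m. [:- r j, 1:]) m = 1"
    and degree_prod_linear: "degree (\<Prod>j<m. [:- r j, 1:]) = m"
    and coeff_prod_linear_second: "coeff (\<Prod>j<Suc m. [:- r j, 1:]) m = - (\<Sum>j<Suc m. r j)"
proof -
  show deg: "degree (\<Prod>j<m. [:- r j, 1:]) = m" for m
    by (subst degree_prod_sum_eq) auto
  have "lead_coeff (\<Prod>j<m. [:- r j, 1:]) = 1" for m
    by (simp add: lead_coeff_prod)
  hence lead: "coeff (\<Prod>j<m. [:- r j, 1:]) m = 1" for m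
    by (simp add: deg)
  thus "coeff (\<Prod>j<m. [:- r j, 1:]) m = 1" .
  show "coeff (\<Prod>j<Suc m. [:- r j, 1:]) m = - (\<Sum>j<Suc m. r j)"
  proof (induction m)
    case 0
    show ?case by simp
  next
    case (Suc m)
    let ?p = "\<Prod>j<Suc m. [:- r j, 1:]"
    have "(\<Prod>j<Suc (Suc m). [:- r j, 1:]) = smult (- r (Suc m)) ?p + pCons 0 ?p"
      by (subst prod.lessThan_Suc) (simp add: mult_pCons_right)
    hence "coeff (\<Prod>j<Suc (Suc m). [:- r j, 1:]) (Suc m)
        = - r (Suc m) * coeff ?p (Suc m) + coeff ?p m"
      by (simp only: coeff_add coeff_smult coeff_pCons_Suc)
    thus ?case
      unfolding lead Suc.IH by simp
  qed
qed

text \<open>The coefficients of degree \<open>N - 1\<close> in the two expressions for the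
  derivative are compared; each is a multiple of a sum of roots.\<close>

lemma centroid_critical_points:
  fixes r s :: "nat \<Rightarrow> complex"
  assumes "0 < N"
    and "pderiv (\<Prod>j<Suc N. [:- r j, 1:]) = smult (of_nat (Suc N)) (\<Prod>j<N. [:- s j, 1:])"
  shows "of_nat N * (\<Sum>j<Suc N. r j) = of_nat (Suc N) * (\<Sum>j<N. s j)"
proof -
  obtain m where N: "N = Suc m"
    using assms(1) gr0_implies_Suc by blast
  have "of_nat (Suc m) * coeff (\<Prod>j<Suc N. [:- r j, 1:]) N
      = of_nat (Suc N) * coeff (\<Prod>j<N. [:- s j, 1:]) m"
    using arg_cong[OF assms(2), of "\<lambda>p. coeff p m"]
    by (simp only: coeff_pderiv coeff_smult N)
  hence "of_nat N * - (\<Sum>j<Suc N. r j) = of_nat (Suc N) * - (\<Sum>j<N. s j)"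
    unfolding coeff_prod_linear_second[of r N] using coeff_prod_linear_second[of s m]
    by (simp only: N)
  thus ?thesis
    by (simp only: mult_minus_right neg_equal_iff_equal)
qed

text \<open>Outside the disc every z/(z - r_j) has positive real part, so \<open>z\<close> times the
  logarithmic derivative of the product cannot vanish.\<close>

lemma Gauss_Lucas_unit_disc:
  fixes r :: "nat \<Rightarrow> complex"
  assumes "0 < m" "\<And>j. j < m \<Longrightarrow> cmod (r j) \<le> 1"
    and root: "poly (pderiv (\<Prod>j<m. [:- r j, 1:])) z = 0"
  shows "cmod z \<le> 1"
proof (rule ccontr)
  assume z: "\<not> cmod z \<le> 1"
  have ne: "z - r j \<noteq> 0" if "j < m" for j
    using assms(2)[OF that] z by auto
  let ?p = "\<Prod>j<m. [:- r j, 1:]"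
  have p: "poly ?p = (\<lambda>x. \<Prod>j<m. (x - r j))"
    by (simp add: poly_prod fun_eq_iff)
  have "((\<lambda>x. \<Prod>j<m. (x - r j)) has_field_derivative
      (\<Prod>j<m. (z - r j)) * (\<Sum>j<m. 1 / (z - r j))) (at z)"
    by (rule has_field_derivative_prod') (use ne in \<open>auto intro!: derivative_eq_intros\<close>)
  hence "poly (pderiv ?p) z = (\<Prod>j<m. (z - r j)) * (\<Sum>j<m. 1 / (z - r j))"
    using poly_DERIV[of ?p z] DERIV_unique unfolding p by blast
  hence "(\<Sum>j<m. 1 / (z - r j)) = 0"
    using root ne by simp
  hence "Re (z * (\<Sum>j<m. 1 / (z - r j))) = 0"
    by simp
  hence "(\<Sum>j<m. Re (z / (z - r j))) = 0"
    by (simp add: sum_distrib_left)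
  moreover have "0 < Re (z / (z - r j))" if "j < m" for j
  proof -
    have "Re (z * cnj (r j)) \<le> cmod z * cmod (r j)"
      using complex_Re_le_cmod[of "z * cnj (r j)"] by (simp add: norm_mult)
    also have "\<dots> \<le> cmod z * 1"
      using assms(2)[OF that] by (intro mult_left_mono) auto
    also have "\<dots> < cmod z * cmod z"
      using z by (intro mult_strict_left_mono) auto
    also have "\<dots> = Re (z * cnj z)"
      by (simp flip: complex_norm_square add: power2_eq_square)
    finally have "0 < Re (z * cnj (z - r j))"
      by (simp add: algebra_simps)
    moreover have "z / (z - r j) = z * cnj (z - r j) / of_real ((cmod (z - r j))\<^sup>2)"
      by (rule complex_div_cnj)
    ultimately show ?thesis
      using ne[OF that] by simp
  qed
  hence "0 < (\<Sum>j<m. Re (z / (z - r j)))"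
    using assms(1) by (intro sum_pos) auto
  ultimately show False
    by simp
qed

text \<open>Each squared factor is at most 1 + y with y = x^2 - 2 x Re r_j, hence at most exp y, and
  the exponents add up.\<close>

lemma norm_prod_linear_le_exp:
  fixes r :: "nat \<Rightarrow> complex" and x :: real
  assumes "\<And>j. j < m \<Longrightarrow> cmod (r j) \<le> 1"
  shows "cmod (\<Prod>j<m. (of_real x - r j)) \<le> exp (m * x\<^sup>2 / 2 - x * (\<Sum>j<m. Re (r j)))"
proof -
  have "(cmod (\<Prod>j<m. (of_real x - r j)))\<^sup>2 = (\<Prod>j<m. (cmod (of_real x - r j))\<^sup>2)"
    by (simp add: prod_norm[symmetric] prod_power_distrib)
  also have "\<dots> \<le> (\<Prod>j<m. exp (x\<^sup>2 - 2 * x * Re (r j)))"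
  proof (intro prod_mono conjI)
    fix j assume "j \<in> {..<m}"
    hence "(cmod (r j))\<^sup>2 \<le> 1"
      using assms by (simp add: power_le_one)
    hence "(cmod (of_real x - r j))\<^sup>2 \<le> 1 + (x\<^sup>2 - 2 * x * Re (r j))"
      by (simp add: cmod_of_real_diff_sq)
    also have "\<dots> \<le> exp (x\<^sup>2 - 2 * x * Re (r j))"
      by (rule exp_ge_add_one_self)
    finally show "(cmod (of_real x - r j))\<^sup>2 \<le> exp (x\<^sup>2 - 2 * x * Re (r j))" .
  qed auto
  also have "\<dots> = exp (2 * (m * x\<^sup>2 / 2 - x * (\<Sum>j<m. Re (r j))))"
    by (simp add: exp_sum[symmetric] sum_subtractf sum_distrib_left algebra_simps)
  also have "\<dots> = (exp (m * x\<^sup>2 / 2 - x * (\<Sum>j<m. Re (r j))))\<^sup>2"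
    by (rule exp_double)
  finally show ?thesis
    by (rule power2_le_imp_le) simp
qed

theorem mainTheorem5:
  fixes a c :: real and zs :: "nat \<Rightarrow> complex" and n :: nat
  assumes "0 < a" "a < 1" "0 < c" "c < a"
    and "n \<ge> 1"
    and "contradicts_sendov a zs n"
    and "real n \<ge> max (N1 a) (N2 a c)"
  shows "cmod (poly (sendov_poly a zs n) (complex_of_real c)) \<le> 1 + a"
proof -
  obtain N where n: "n = Suc N"
    using assms(5) by (cases n) auto
  \<comment> \<open>Index 0 is free in \<open>zs\<close>, so placing \<open>a\<close> there turns
    all zeros into one family indexed below \<open>Suc N\<close>.\<close>
  define r where "r j = (if j = 0 then complex_of_real a else zs j)" for j
  define p where "p = (\<Prod>j<Suc N. [:- r j, 1:])"
  have zs: "cmod (zs j) \<le> 1" if "1 \<le> j" "j \<le> N" for j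
    using assms(6) that by (auto simp: contradicts_sendov_def n)
  have r: "cmod (r j) \<le> 1" if "j < Suc N" for j
    using zs[of j] that assms(1,2) by (auto simp: r_def)
  have "{..<Suc N} = insert 0 {1..N}"
    by auto
  hence p_eq: "sendov_poly a zs n = p"
    by (simp add: p_def sendov_poly_def n r_def)

  have large: "9 * ((4 + 2 * a) / a)\<^sup>2 \<le> real (Suc N)" "32 * ln (40 / a\<^sup>2) / a\<^sup>2 \<le> real (Suc N)"
    using assms(7) by (auto simp: N1_def N0_def n)
  \<comment> \<open>This makes the degree at least 36, so critical points exist and their centroid
    is a genuine quotient.\<close>
  have "2\<^sup>2 \<le> ((4 + 2 * a) / a)\<^sup>2"
    using assms(1,2) by (intro power_mono) (auto simp: field_simps)
  hence N_pos: "0 < N"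
    using large(1) by (cases N) auto

  have deg: "degree (pderiv p) = N"
    by (simp add: degree_pderiv p_def degree_prod_linear del: prod.lessThan_Suc)
  have lead: "lead_coeff (pderiv p) = of_nat (Suc N)"
    unfolding deg coeff_pderiv unfolding p_def coeff_prod_linear_lead by simp
  \<comment> \<open>The fundamental theorem of algebra lists the critical points with
    multiplicity.\<close>
  obtain w where w: "smult (lead_coeff (pderiv p)) (\<Prod>j<degree (pderiv p). [:- w j, 1:]) = pderiv p"
    by (rule complex_poly_decompose')
  hence p': "pderiv p = smult (of_nat (Suc N)) (\<Prod>j<N. [:- w j, 1:])"
    unfolding lead unfolding deg by (rule sym)
  have w_root: "poly (pderiv p) (w j) = 0" if "j < N" for j
    unfolding p' using that by (auto simp: poly_prod)
  have "of_nat N * (\<Sum>j<Suc N. r j) = of_nat (Suc N) * (\<Sum>j<N. w j)"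
    using N_pos p' unfolding p_def by (rule centroid_critical_points)
  hence "Re (of_nat N * (\<Sum>j<Suc N. r j)) = Re (of_nat (Suc N) * (\<Sum>j<N. w j))"
    by (rule arg_cong)
  hence "real N * (\<Sum>j<Suc N. Re (r j)) = real (Suc N) * (\<Sum>j<N. Re (w j))"
    by (simp only: Re_sum complex_Re_of_nat complex_Im_of_nat times_complex.sel mult_zero_left diff_zero)
  hence centroid: "(\<Sum>j<Suc N. Re (r j)) = real (Suc N) * ((\<Sum>j<N. Re (w j)) / N)"
    using N_pos by (simp add: field_simps del: sum.lessThan_Suc)

  interpret lune_points a N w
  proof
    show "cmod (w j) \<le> 1" if "j < N" for j
      using Gauss_Lucas_unit_disc[of "Suc N" r "w j"] r w_root[OF that] by (simp add: p_def)
    show "1 < cmod (w j - of_real a)" if "j < N" for j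
      using assms(6) w_root[OF that] by (simp add: contradicts_sendov_def p_eq)
  qed (use assms in auto)
  interpret sendov_counterexample a N w "poly p"
  proof
    show "(poly p has_field_derivative of_nat (Suc N) * D z) (at z)" for z
      using poly_DERIV[of p z] by (simp add: p' D_def poly_prod)
    show "poly p (of_real a) = 0"
      by (auto simp: p_def poly_prod r_def)
    have "cmod (poly p 0) = a * (\<Prod>j=1..N. cmod (zs j))"
      using assms(1) by (simp add: p_eq[symmetric] sendov_poly_def n poly_prod norm_mult prod_norm[symmetric])
    also have "\<dots> \<le> a * 1"
      using assms(1) zs by (intro mult_left_mono prod_le_1) auto
    finally show "cmod (poly p 0) \<le> a"
      by simp
    show "cmod (poly p (of_real x))
        \<le> exp (real (Suc N) * (x\<^sup>2 / 2 - x * ((\<Sum>j<N. Re (w j)) / N)))" for x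
    proof -
      have "cmod (poly p (of_real x)) = cmod (\<Prod>j<Suc N. (of_real x - r j))"
        by (simp add: p_def poly_prod del: prod.lessThan_Suc)
      also have "\<dots> \<le> exp (real (Suc N) * x\<^sup>2 / 2 - x * (\<Sum>j<Suc N. Re (r j)))"
        using r by (rule norm_prod_linear_le_exp)
      also have "real (Suc N) * x\<^sup>2 / 2 - x * (\<Sum>j<Suc N. Re (r j))
          = real (Suc N) * (x\<^sup>2 / 2 - x * ((\<Sum>j<N. Re (w j)) / N))"
        unfolding centroid by (simp add: right_diff_distrib mult_ac)
      finally show ?thesis .
    qed
  qed (use large in auto)
  show ?thesis
    unfolding p_eq using norm_P_le assms(3,4) .
qed

end
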